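(* Let $p(\cdot):\mathbb{R}^n\to[1,\infty]$ be measurable with $p_+:=\operatorname{ess\,sup}_{x\in\mathbb{R}^n}p(x)<\infty$. Let $\rho=\{\rho_x\}_{x\in\mathbb{R}^n}$ be a family of norms on $\mathbb{C}^d$, and suppose that for every $x\in\mathbb{R}^n$ there is a positive-definite self-adjoint matrix $W_x$ with $$\rho_x(\mathbf{v})\le |W_x\mathbf{v}|\le d^{1/2}\rho_x(\mathbf{v})\quad\text{for all }\mathbf{v}\in\mathbb{C}^d,$$ where $x\mapsto W_x$ is an invertible matrix weight on $\mathbb{R}^n$ and $\|W_x\|_{op}^{p_+}\in L^1_{\rm loc}(\mathbb{R}^n)$. A subset $\mathcal{F}\subset L^{p(\cdot)}(\rho)$ is totally bounded in $L^{p(\cdot)}(\rho)$ if the following hold: (a) $\sup_{\mathbf{f}\in\mathcal{F}}\int_{\mathbb{R}^n}[\rho_x(\mathbf{f}(x))]^{p(x)}dx<\infty$; (b) $\lim_{R\to\infty}\sup_{\mathbf{f}\in\mathcal{F}}\int_{B^c(0,R)}[\rho_x(\mathbf{f}(x))]^{p(x)}dx=0$; (c) $\lim_{r\to0}\sup_{\mathbf{f}\in\mathcal{F}}\sup_{y\in B(0,r)}\int_{\mathbb{R}^n}[\rho_x(\tau_y\mathbf{f}(x)-\mathbf{f}(x))]^{p(x)}dx=0$, where $\tau_y\mathbf{f}(x):=\mathbf{f}(x-y)$.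
   Context: Lebesgue measure on $\mathbb{R}^n$ is used throughout; $B(0,R)$ is the Euclidean ball, $B^c$ its complement. It is assumed that $x\mapsto\rho_x(\mathbf{f}(x))$ is measurable for every measurable $\mathbf{f}:\mathbb{R}^n\to\mathbb{C}^d$. $L^{p(\cdot)}(\rho)$ is the set of measurable $\mathbf{f}:\mathbb{R}^n\to\mathbb{C}^d$ with $\int_{\mathbb{R}^n}[\rho_x(\mathbf{f}(x))]^{p(x)}dx<\infty$, normed by the Luxemburg norm $\|\mathbf{f}\|_{L^{p(\cdot)}(\rho)}:=\inf\{\lambda>0:\int_{\mathbb{R}^n}[\rho_x(\mathbf{f}(x))/\lambda]^{p(x)}dx\le1\}$. A matrix weight is a measurable map $W:\mathbb{R}^n\to\mathcal{S}_d$ (self-adjoint non-negative-definite complex $d\times d$ matrices) with $\|W\|_{op}\in L^1_{\rm loc}(\mathbb{R}^n)$; it is invertible if $\det W(x)\ne0$ a.e. $\|\cdot\|_{op}$ is the operator norm and $|\cdot|$ the Euclidean norm on $\mathbb{C}^d$. *)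

theory Defs
  imports "HOL-Analysis.Analysis" "HOL-Probability.Essential_Supremum"
begin

definition conj_transpose :: "complex^'d^'d \<Rightarrow> complex^'d^'d" where
  "conj_transpose A = (\<chi> i j. cnj (A $ j $ i))"

definition cinner :: "complex^'d \<Rightarrow> complex^'d \<Rightarrow> complex" where
  "cinner v w = (\<Sum>i\<in>UNIV. cnj (v $ i) * w $ i)"

definition self_adjoint :: "complex^'d^'d \<Rightarrow> bool" where
  "self_adjoint A \<longleftrightarrow> conj_transpose A = A"

definition pos_def :: "complex^'d^'d \<Rightarrow> bool" where
  "pos_def A \<longleftrightarrow> (\<forall>v. v \<noteq> 0 \<longrightarrow> 0 < Re (cinner v (A *v v)))"

definition op_norm :: "complex^'d^'d \<Rightarrow> real" where
  "op_norm A = onorm (\<lambda>v. A *v v)"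

definition is_cnorm :: "(complex^'d \<Rightarrow> real) \<Rightarrow> bool" where
  "is_cnorm N \<longleftrightarrow> (\<forall>v. 0 \<le> N v) \<and> (\<forall>v. N v = 0 \<longleftrightarrow> v = 0)
     \<and> (\<forall>c v. N (c *s v) = cmod c * N v) \<and> (\<forall>v w. N (v + w) \<le> N v + N w)"

definition loc_integrable :: "(real^'n \<Rightarrow> real) \<Rightarrow> bool" where
  "loc_integrable g \<longleftrightarrow> (\<forall>K. compact K \<longrightarrow> set_integrable lebesgue K g)"

definition matrix_weight :: "(real^'n \<Rightarrow> complex^'d^'d) \<Rightarrow> bool" where
  "matrix_weight W \<longleftrightarrow> W \<in> borel_measurable lebesgue
     \<and> (\<forall>x. self_adjoint (W x) \<and> (\<forall>v. 0 \<le> Re (cinner v (W x *v v))))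
     \<and> loc_integrable (\<lambda>x. op_norm (W x))"

definition invertible_matrix_weight :: "(real^'n \<Rightarrow> complex^'d^'d) \<Rightarrow> bool" where
  "invertible_matrix_weight W \<longleftrightarrow> matrix_weight W \<and> (AE x in lebesgue. det (W x) \<noteq> 0)"

text \<open>Modular \<open>\<integral> [\<rho>_x(f(x))]^{p(x)} dx\<close> over a set \<open>A\<close>. The exponent \<open>p\<close> takes values in
  \<open>[1,\<infinity>]\<close>; under the standing hypothesis \<open>p_+ < \<infinity>\<close> the set \<open>{p = \<infinity>}\<close> is null, so the
  value used there is irrelevant.\<close>
definition modular_on ::
  "(real^'n \<Rightarrow> ereal) \<Rightarrow> (real^'n \<Rightarrow> complex^'d \<Rightarrow> real) \<Rightarrow> (real^'n) set
    \<Rightarrow> (real^'n \<Rightarrow> complex^'d) \<Rightarrow> ennreal" where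
  "modular_on p \<rho> A f = (\<integral>\<^sup>+ x\<in>A. ennreal ((\<rho> x (f x)) powr real_of_ereal (p x)) \<partial>lebesgue)"

abbreviation modular where "modular p \<rho> f \<equiv> modular_on p \<rho> UNIV f"

definition Lpvar :: "(real^'n \<Rightarrow> ereal) \<Rightarrow> (real^'n \<Rightarrow> complex^'d \<Rightarrow> real)
    \<Rightarrow> (real^'n \<Rightarrow> complex^'d) set" where
  "Lpvar p \<rho> = {f. f \<in> borel_measurable lebesgue \<and> modular p \<rho> f < \<infinity>}"

definition lux_norm :: "(real^'n \<Rightarrow> ereal) \<Rightarrow> (real^'n \<Rightarrow> complex^'d \<Rightarrow> real)
    \<Rightarrow> (real^'n \<Rightarrow> complex^'d) \<Rightarrow> real" where
  "lux_norm p \<rho> f = Inf {t::real. t > 0 \<and>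
     (\<integral>\<^sup>+ x. ennreal ((\<rho> x (f x) / t) powr real_of_ereal (p x)) \<partial>lebesgue) \<le> 1}"

definition lux_totally_bounded :: "(real^'n \<Rightarrow> ereal) \<Rightarrow> (real^'n \<Rightarrow> complex^'d \<Rightarrow> real)
    \<Rightarrow> (real^'n \<Rightarrow> complex^'d) set \<Rightarrow> bool" where
  "lux_totally_bounded p \<rho> F \<longleftrightarrow> (\<forall>e>0. \<exists>k. finite k \<and> k \<subseteq> F \<and>
     (\<forall>f\<in>F. \<exists>g\<in>k. lux_norm p \<rho> (\<lambda>x. f x - g x) < e))"

end

theory Submission
  imports Defs
begin

text \<open>Replacing \<open>\<rho>\<^sub>x(v)\<close> by \<open>|W\<^sub>x v|\<close> changes modulars by a bounded factor only. Partition \<open>\<real>\<^sup>n\<close> into cubes \<open>Q\<close>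
  of side \<open>d\<close>. For \<open>f\<close> in the family, averaging over \<open>z \<in> Q\<close> yields a sample point \<open>z\<^sub>Q\<close> for which the
  modular of \<open>f - f(z\<^sub>Q)\<close> over \<open>Q\<close> is at most the mean over \<open>Q\<close>; summing over the cubes and applying
  Tonelli bounds the total by \<open>2\<^sup>n\<close> times the supremum in (c), because \<open>Q - Q\<close> lies in a cube
  of side \<open>2d\<close>. Sampling, unlike averaging \<open>f\<close> itself, needs no local integrability of \<open>f\<close>.
  By (b) finitely many cubes matter, and by (a) together with the invertibility of \<open>W\<close> the sampled
  values range over a bounded subset of \<open>\<complex>\<^sup>d\<close>. Functions whose sampled values are close on these
  cubes are close in the modular, as \<open>\<parallel>W\<parallel>\<close> to the power \<open>p\<^sub>+\<close> is locally integrable.\<close>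

section \<open>Measure-theoretic preliminaries\<close>

text \<open>If \<open>g\<close> exceeded its mean at every point of \<open>Q\<close>, integrating
  the strict inequality would give a contradiction. The mean is multiplied out, so an infinite
  integral is allowed as well.\<close>

lemma ex_le_set_nn_integral:
  fixes g :: "'a \<Rightarrow> ennreal"
  assumes [measurable]: "g \<in> borel_measurable M" "Q \<in> sets M"
    and Q: "emeasure M Q \<noteq> 0" "emeasure M Q \<noteq> \<infinity>"
  shows "\<exists>z\<in>Q. emeasure M Q * g z \<le> (\<integral>\<^sup>+z\<in>Q. g z \<partial>M)"
proof (rule ccontr)
  let ?A = "\<integral>\<^sup>+z\<in>Q. g z \<partial>M"
  let ?c = "?A / emeasure M Q"
  assume "\<not> ?thesis"
  then have gt: "?A < emeasure M Q * g z" if "z \<in> Q" for z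
    using that by (meson not_le)
  have "Q \<noteq> {}" using Q by auto
  then obtain w where "w \<in> Q" by blast
  from gt[OF this] have A: "?A \<noteq> \<infinity>" by auto
  have gt': "?c < g z" if "z \<in> Q" for z
    using gt[OF that] Q
    by (subst divide_less_ennreal) (simp_all only: mult.commute[of "g z"], auto simp: less_top zero_less_iff_neq_zero)
  have eq: "(\<integral>\<^sup>+z. ?c * indicator Q z \<partial>M) = ?A"
  proof -
    have "?c * emeasure M Q = ?A"
      using mult_divide_eq_ennreal[of "emeasure M Q" ?A] Q
      by (simp only: mult.commute[of ?c] ennreal_times_divide mult.commute[of _ ?A]) simp
    then show ?thesis by (subst nn_integral_cmult_indicator) auto
  qed
  have "(\<integral>\<^sup>+z. ?c * indicator Q z \<partial>M) < ?A"
  proof (rule nn_integral_less)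
    show "AE z in M. ?c * indicator Q z \<le> g z * indicator Q z"
      using gt' by (intro AE_I2) (auto simp: indicator_def intro: less_imp_le)
    show "\<not> (AE z in M. g z * indicator Q z \<le> ?c * indicator Q z)"
    proof
      assume "AE z in M. g z * indicator Q z \<le> ?c * indicator Q z"
      then have "AE z in M. z \<notin> Q"
      proof eventually_elim
        case (elim z)
        then show ?case using gt'[of z] by (cases "z \<in> Q") (auto simp: not_le[symmetric])
      qed
      then have "Q \<in> null_sets M" by (subst AE_iff_null_sets) auto
      then show False using Q by auto
    qed
    show "(\<integral>\<^sup>+z. ?c * indicator Q z \<partial>M) \<noteq> \<infinity>" unfolding eq by (rule A)
  qed measurable
  then show False unfolding eq by simp
qed

lemma nn_integral_lborel_reflect:
  fixes f :: "'a::euclidean_space \<Rightarrow> ennreal"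
  assumes [measurable]: "f \<in> borel_measurable borel"
  shows "(\<integral>\<^sup>+z. f z \<partial>lborel) = (\<integral>\<^sup>+y. f (x - y) \<partial>lborel)"
  by (subst lborel_affine[of "-1" x]) (simp_all add: nn_integral_density nn_integral_distr density_1)

text \<open>The sampling argument in abstract form: \<open>z k\<close> is a point where the integral
  over \<open>Q k\<close> is at most its mean over \<open>z\<close> in \<open>Q k\<close>. The
  products of \<open>Q k\<close> with itself lie in the strip where \<open>x - z\<close> belongs to
  \<open>D\<close>. The substitution \<open>y = x - z\<close> and Tonelli turn the integral over
  this strip into an integral over \<open>D\<close> of quantities bounded by
  \<open>e\<close>.\<close>

lemma sample_points:
  fixes H :: "'a::euclidean_space \<Rightarrow> 'a \<Rightarrow> ennreal"
  assumes H: "(\<lambda>(x, z). H x z) \<in> borel_measurable borel"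
    and S: "finite S" and Q: "\<And>k. k \<in> S \<Longrightarrow> Q k \<in> sets borel"
    and c: "\<And>k. k \<in> S \<Longrightarrow> emeasure lborel (Q k) = c" "c \<noteq> 0" "c \<noteq> \<infinity>"
    and disj: "disjoint_family_on Q S"
    and D: "D \<in> sets borel" "\<And>k x z. k \<in> S \<Longrightarrow> x \<in> Q k \<Longrightarrow> z \<in> Q k \<Longrightarrow> x - z \<in> D"
    and le: "\<And>y. y \<in> D \<Longrightarrow> (\<integral>\<^sup>+x. H x (x - y) \<partial>lborel) \<le> e"
  shows "\<exists>z. (\<forall>k\<in>S. z k \<in> Q k) \<and> c * (\<Sum>k\<in>S. \<integral>\<^sup>+x\<in>Q k. H x (z k) \<partial>lborel) \<le> emeasure lborel D * e"
proof -
  have [measurable]: "(\<lambda>(x, z). H x z) \<in> borel_measurable (lborel \<Otimes>\<^sub>M lborel)"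
    using H by (simp add: lborel_prod)
  note [measurable] = D(1)
  have "\<exists>z\<in>Q k. c * (\<integral>\<^sup>+x\<in>Q k. H x z \<partial>lborel)
      \<le> (\<integral>\<^sup>+z\<in>Q k. (\<integral>\<^sup>+x\<in>Q k. H x z \<partial>lborel) \<partial>lborel)" if k: "k \<in> S" for k
  proof -
    note [measurable] = Q[OF k]
    show ?thesis
      using ex_le_set_nn_integral[of "\<lambda>z. \<integral>\<^sup>+x\<in>Q k. H x z \<partial>lborel" lborel "Q k"] c Q k by simp
  qed
  then have "\<forall>k\<in>S. \<exists>z. z \<in> Q k \<and> c * (\<integral>\<^sup>+x\<in>Q k. H x z \<partial>lborel)
      \<le> (\<integral>\<^sup>+z\<in>Q k. (\<integral>\<^sup>+x\<in>Q k. H x z \<partial>lborel) \<partial>lborel)"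
    by blast
  from bchoice[OF this] obtain z where z: "\<And>k. k \<in> S \<Longrightarrow> z k \<in> Q k" "\<And>k. k \<in> S \<Longrightarrow> c * (\<integral>\<^sup>+x\<in>Q k. H x (z k) \<partial>lborel)
      \<le> (\<integral>\<^sup>+z\<in>Q k. (\<integral>\<^sup>+x\<in>Q k. H x z \<partial>lborel) \<partial>lborel)"
    by blast
  have "c * (\<Sum>k\<in>S. \<integral>\<^sup>+x\<in>Q k. H x (z k) \<partial>lborel) 
      \<le> (\<Sum>k\<in>S. \<integral>\<^sup>+z\<in>Q k. (\<integral>\<^sup>+x\<in>Q k. H x z \<partial>lborel) \<partial>lborel)"
    using z(2) by (auto simp: sum_distrib_left intro!: sum_mono)
  also have "\<dots> = (\<Sum>k\<in>S. \<integral>\<^sup>+z. (\<integral>\<^sup>+x. H x z * indicator (Q k) x * indicator (Q k) z \<partial>lborel) \<partial>lborel)"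
  proof (intro sum.cong refl nn_integral_cong)
    fix k z assume k: "k \<in> S"
    note [measurable] = Q[OF k]
    show "(\<integral>\<^sup>+x\<in>Q k. H x z \<partial>lborel) * indicator (Q k) z
        = (\<integral>\<^sup>+x. H x z * indicator (Q k) x * indicator (Q k) z \<partial>lborel)"
      by (subst nn_integral_multc) auto
  qed
  also have "\<dots> = (\<integral>\<^sup>+z. (\<integral>\<^sup>+x. (\<Sum>k\<in>S. H x z * indicator (Q k) x * indicator (Q k) z) \<partial>lborel) \<partial>lborel)"
  proof -
    have m: "(\<lambda>(x, z). H x z * indicator (Q k) x * indicator (Q k) z) \<in> borel_measurable (lborel \<Otimes>\<^sub>M lborel)"
      if "k \<in> S" for k
    proof -
      note [measurable] = Q[OF that]
      show ?thesis by measurable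
    qed
    have m2: "(\<lambda>z. \<integral>\<^sup>+x. H x z * indicator (Q k) x * indicator (Q k) z \<partial>lborel) \<in> borel_measurable lborel"
      "(\<lambda>x. H x z * indicator (Q k) x * indicator (Q k) z) \<in> borel_measurable lborel" if "k \<in> S" for k z
    proof -
      note [measurable] = m[OF that]
      show "(\<lambda>z. \<integral>\<^sup>+x. H x z * indicator (Q k) x * indicator (Q k) z \<partial>lborel) \<in> borel_measurable lborel"
        by measurable
      note [measurable] = Q[OF that]
      show "(\<lambda>x. H x z * indicator (Q k) x * indicator (Q k) z) \<in> borel_measurable lborel" by measurable
    qed
    have "(\<Sum>k\<in>S. \<integral>\<^sup>+z. (\<integral>\<^sup>+x. H x z * indicator (Q k) x * indicator (Q k) z \<partial>lborel) \<partial>lborel)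
      = (\<integral>\<^sup>+z. (\<Sum>k\<in>S. \<integral>\<^sup>+x. H x z * indicator (Q k) x * indicator (Q k) z \<partial>lborel) \<partial>lborel)"
      by (rule nn_integral_sum[symmetric]) (rule m2(1))
    also have "\<dots> = (\<integral>\<^sup>+z. (\<integral>\<^sup>+x. (\<Sum>k\<in>S. H x z * indicator (Q k) x * indicator (Q k) z) \<partial>lborel) \<partial>lborel)"
      by (intro nn_integral_cong nn_integral_sum[symmetric] m2(2))
    finally show ?thesis .
  qed
  \<comment> \<open>Since the \<open>Q k\<close> are disjoint, at most one summand is nonzero for
    given \<open>x\<close> and \<open>z\<close>, so the sum is dominated by \<open>H x z\<close>
    restricted to the strip.\<close>
  also have "\<dots> \<le> (\<integral>\<^sup>+z. (\<integral>\<^sup>+x. H x z * indicator D (x - z) \<partial>lborel) \<partial>lborel)"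
  proof (intro nn_integral_mono)
    fix x z :: 'a
    show "(\<Sum>k\<in>S. H x z * indicator (Q k) x * indicator (Q k) z) \<le> H x z * indicator D (x - z)"
    proof (cases "\<exists>k\<in>S. x \<in> Q k \<and> z \<in> Q k")
      case True
      then obtain k where k: "k \<in> S" "x \<in> Q k" "z \<in> Q k" by auto
      have "(\<Sum>j\<in>S. H x z * indicator (Q j) x * indicator (Q j) z) = (\<Sum>j\<in>{k}. H x z * indicator (Q j) x * indicator (Q j) z)"
        using k disj S by (intro sum.mono_neutral_right) (auto simp: indicator_def disjoint_family_on_def)
      then show ?thesis using k D(2)[OF k] by simp
    next
      case False
      then have "(\<Sum>k\<in>S. H x z * indicator (Q k) x * indicator (Q k) z) = 0"
        by (intro sum.neutral) (auto simp: indicator_def)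
      then show ?thesis by simp
    qed
  qed
  also have "\<dots> = (\<integral>\<^sup>+x. (\<integral>\<^sup>+z. H x z * indicator D (x - z) \<partial>lborel) \<partial>lborel)"
    by (rule lborel_pair.Fubini') measurable
  also have "\<dots> = (\<integral>\<^sup>+x. (\<integral>\<^sup>+y. H x (x - y) * indicator D y \<partial>lborel) \<partial>lborel)"
  proof (rule nn_integral_cong)
    fix x
    have "(\<lambda>z. H x z * indicator D (x - z)) \<in> borel_measurable lborel" by measurable
    with nn_integral_lborel_reflect[of "\<lambda>z. H x z * indicator D (x - z)" x]
    show "(\<integral>\<^sup>+z. H x z * indicator D (x - z) \<partial>lborel) = (\<integral>\<^sup>+y. H x (x - y) * indicator D y \<partial>lborel)"
      by simp
  qed
  also have "\<dots> = (\<integral>\<^sup>+y. (\<integral>\<^sup>+x. H x (x - y) * indicator D y \<partial>lborel) \<partial>lborel)"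
    by (rule lborel_pair.Fubini'[symmetric]) measurable
  also have "\<dots> \<le> (\<integral>\<^sup>+y. e * indicator D y \<partial>lborel)"
    using le by (intro nn_integral_mono) (auto simp: indicator_def)
  also have "\<dots> = emeasure lborel D * e"
    by (subst nn_integral_cmult_indicator) (auto simp: mult.commute)
  finally show ?thesis using z(1) by auto
qed

text \<open>Each coordinate agrees almost everywhere with a Borel function, and finitely many null
  sets unite to a null set. Borel versions are wanted because \<open>sample_points\<close> asks for
  an integrand that is jointly Borel in \<open>x\<close> and \<open>z\<close>.\<close>

lemma lebesgue_ex_borel_measurable:
  fixes f :: "'a::euclidean_space \<Rightarrow> 'b::euclidean_space"
  assumes "f \<in> borel_measurable lebesgue"
  shows "\<exists>g\<in>borel_measurable borel. AE x in lebesgue. f x = g x"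
proof -
  have "\<forall>b\<in>Basis. \<exists>g\<in>borel_measurable lborel. AE x in lborel. f x \<bullet> b = g x"
    using assms 
    by (intro ballI completion_ex_borel_measurable_real) simp
  from bchoice[OF this[unfolded Bex_def]] obtain g where g: "\<And>b. b \<in> Basis \<Longrightarrow> g b \<in> borel_measurable lborel"
    "\<And>b. b \<in> Basis \<Longrightarrow> AE x in lborel. f x \<bullet> b = g b x"
    by blast
  let ?g = "\<lambda>x. \<Sum>b\<in>Basis. g b x *\<^sub>R b"
  have "AE x in lborel. \<forall>b\<in>Basis. f x \<bullet> b = g b x"
    using g(2) by (subst AE_finite_all) auto
  then have "AE x in lebesgue. f x = ?g x"
  proof (intro AE_completion, eventually_elim)
    case (elim x)
    have "f x = (\<Sum>b\<in>Basis. (f x \<bullet> b) *\<^sub>R b)" by (rule euclidean_representation[symmetric])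
    also have "\<dots> = ?g x" using elim by (intro sum.cong) simp_all
    finally show ?case .
  qed
  moreover have "?g \<in> borel_measurable borel" using g(1) by simp
  ultimately show ?thesis by (intro bexI[of _ ?g])
qed

lemma lebesgue_translation_measurable:
  "(\<lambda>x. x - y) \<in> measurable lebesgue (lebesgue :: 'a::euclidean_space measure)"
  using lebesgue_affine_measurable[of "\<lambda>_. 1" "- y"] by (simp add: euclidean_representation)

text \<open>The exceptional set lies in a Borel null set, whose translates are null. This permits
  replacing \<open>f\<close> by a Borel version inside \<open>f (x - y)\<close>.\<close>

lemma AE_lebesgue_translation:
  fixes y :: "'a::euclidean_space"
  assumes "AE x in lebesgue. P x"
  shows "AE x in lebesgue. P (x - y)"
proof -
  have "AE x in lborel. P x" using assms by (simp add: AE_completion_iff)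
  then obtain N where "{x. \<not> P x} \<subseteq> N" "N \<in> null_sets lborel"
    by (auto elim!: AE_E simp: null_sets_def)
  then have "AE x in lborel. P (x - y)"
    using null_sets_translation[of N y] by (intro AE_I'[of "{x. x - y \<in> N}"]) auto
  then show ?thesis by (rule AE_completion)
qed

section \<open>Cubes\<close>

text \<open>The half-open sides make the cubes of mesh \<open>d > 0\<close>, indexed by integer
  vectors, an exact partition of space without common faces.\<close>

definition cell :: "real \<Rightarrow> ('n \<Rightarrow> int) \<Rightarrow> (real^'n) set" where
  "cell d k = {x. \<forall>i. d * of_int (k i) \<le> x $ i \<and> x $ i < d * (of_int (k i) + 1)}"

lemma cell_sets_borel [measurable]: "cell d k \<in> sets borel"
  unfolding cell_def by measurable

lemma cell_subset_cbox: "cell d k \<subseteq> cbox (\<chi> i. d * of_int (k i)) (\<chi> i. d * (of_int (k i) + 1))"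
  by (force simp: cell_def mem_box_cart intro: less_imp_le)

lemma prod_Basis_cart_const:
  fixes f :: "real^'n \<Rightarrow> real"
  assumes "\<And>i. f (axis i 1) = c"
  shows "prod f Basis = c ^ CARD('n)"
proof -
  have "prod f Basis = prod (\<lambda>_. c) (Basis :: (real^'n) set)"
    using assms by (intro prod.cong) (auto simp: Basis_vec_def)
  then show ?thesis by simp
qed

text \<open>The half-open cube lies between the open and the closed box with the same corners, and
  these have equal volume.\<close>

lemma emeasure_cell:
  fixes k :: "'n::finite \<Rightarrow> int"
  assumes "0 < d"
  shows "emeasure lborel (cell d k) = ennreal (d ^ CARD('n))"
proof (rule antisym)
  let ?a = "(\<chi> i. d * of_int (k i)) :: real^'n" and ?b = "(\<chi> i. d * (of_int (k i) + 1)) :: real^'n"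
  have ab: "?a \<bullet> b \<le> ?b \<bullet> b" if "b \<in> Basis" for b
    using that assms by (auto simp: Basis_vec_def inner_axis mult_left_mono)
  have prod: "(\<Prod>b\<in>Basis. (?b - ?a) \<bullet> b) = d ^ CARD('n)"
    by (rule prod_Basis_cart_const) (simp add: inner_axis algebra_simps)
  have "emeasure lborel (cell d k) \<le> emeasure lborel (cbox ?a ?b)"
    by (intro emeasure_mono cell_subset_cbox) simp
  also have "\<dots> = ennreal (d ^ CARD('n))"
    by (subst emeasure_lborel_cbox[OF ab]) (simp_all only: prod)
  finally show "emeasure lborel (cell d k) \<le> ennreal (d ^ CARD('n))" .
  have "ennreal (d ^ CARD('n)) = emeasure lborel (box ?a ?b)"
    by (subst emeasure_lborel_box[OF ab]) (simp_all only: prod)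
  also have "\<dots> \<le> emeasure lborel (cell d k)"
    by (intro emeasure_mono) (force simp: cell_def mem_box_cart intro: less_imp_le)+
  finally show "ennreal (d ^ CARD('n)) \<le> emeasure lborel (cell d k)" .
qed

lemma emeasure_centered_box:
  assumes "0 < d"
  shows "emeasure lborel (box (\<chi> i. - d) (\<chi> i. d) :: (real^'n) set) = ennreal ((2 * d) ^ CARD('n))"
proof -
  let ?a = "(\<chi> i. - d) :: real^'n" and ?b = "(\<chi> i. d) :: real^'n"
  have ab: "?a \<bullet> b \<le> ?b \<bullet> b" if "b \<in> Basis" for b
    using that assms by (auto simp: Basis_vec_def inner_axis)
  have prod: "(\<Prod>b\<in>Basis. (?b - ?a) \<bullet> b) = (2 * d) ^ CARD('n)"
    by (rule prod_Basis_cart_const) (simp add: inner_axis)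
  show ?thesis
    by (subst emeasure_lborel_box[OF ab]) (simp_all only: prod)
qed

text \<open>The Euclidean norm is at most the sum of the absolute coordinates. This fits the
  differences of points of one cell into the ball of condition (c).\<close>

lemma centered_box_subset_ball:
  assumes "0 < d" "real CARD('n) * d \<le> r"
  shows "box (\<chi> i. - d) (\<chi> i. d) \<subseteq> ball (0 :: real^'n) r"
proof
  fix x :: "real^'n" assume "x \<in> box (\<chi> i. - d) (\<chi> i. d)"
  then have "\<bar>x $ i\<bar> < d" for i by (auto simp: mem_box_cart abs_less_iff minus_less_iff)
  then have "(\<Sum>i\<in>UNIV. \<bar>x $ i\<bar>) < (\<Sum>i\<in>(UNIV::'n set). d)"
    by (intro sum_strict_mono) auto
  then show "x \<in> ball 0 r" using norm_le_l1_cart[of x] assms(2) by simp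
qed

text \<open>A point determines the index of its cell; both disjointness and covering follow from
  this.\<close>

lemma cell_eq_floor: "0 < d \<Longrightarrow> x \<in> cell d k \<longleftrightarrow> (\<forall>i. k i = \<lfloor>x $ i / d\<rfloor>)"
  by (auto simp: cell_def field_simps eq_commute[of "k _"] floor_eq_iff)

lemma disjoint_cells: "0 < d \<Longrightarrow> disjoint_family_on (cell d) S"
  by (auto simp: disjoint_family_on_def cell_eq_floor)

lemma cell_diff_mem_box:
  "0 < d \<Longrightarrow> x \<in> cell d k \<Longrightarrow> z \<in> cell d k \<Longrightarrow> x - z \<in> box (\<chi> i. - d) (\<chi> i. d)"
  unfolding cell_def mem_box_cart
  by (auto simp: algebra_simps) (smt (verit, best))+

lemma finite_cells_cover_ball:
  fixes R :: real
  assumes "0 < d"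
  obtains S :: "('n::finite \<Rightarrow> int) set" where "finite S" "ball 0 R \<subseteq> (\<Union>k\<in>S. cell d k)"
proof
  \<comment> \<open>Coordinates of points in the ball have modulus at most \<open>R\<close>, so the
    floors of \<open>x $ i / d\<close> stay within these bounds.\<close>
  let ?m = "\<lceil>R / d\<rceil> + 1"
  let ?S = "{k :: 'n \<Rightarrow> int. \<forall>i. k i \<in> {- ?m..?m}}"
  have "?S = (UNIV \<rightarrow>\<^sub>E {- ?m..?m})" by (auto simp: PiE_UNIV_domain)
  then show "finite ?S" by (simp add: finite_PiE)
  show "ball 0 R \<subseteq> (\<Union>k\<in>?S. cell d k)"
  proof
    fix x :: "real^'n" assume x: "x \<in> ball 0 R"
    let ?k = "\<lambda>i. \<lfloor>x $ i / d\<rfloor>"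
    have "?k i \<in> {- ?m..?m}" for i
    proof -
      have "\<bar>x $ i\<bar> \<le> R" using x component_le_norm_cart[of x i] by simp
      then have "- (R / d) \<le> x $ i / d" "x $ i / d \<le> R / d"
        using assms by (auto simp: field_simps)
      then show ?thesis unfolding atLeastAtMost_iff by linarith
    qed
    moreover have "x \<in> cell d ?k" using assms by (simp add: cell_eq_floor)
    ultimately show "x \<in> (\<Union>k\<in>?S. cell d k)" by blast
  qed
qed

section \<open>The matrix-weighted integrand\<close>

lemma borel_measurable_matrix_vector_mult [measurable (raw)]:
  fixes A :: "'a \<Rightarrow> complex^'m^'n"
  assumes "A \<in> borel_measurable M" "v \<in> borel_measurable M"
  shows "(\<lambda>x. A x *v v x) \<in> borel_measurable M"
proof (rule borel_measurable_continuous_Pair[OF assms])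
  show "continuous_on UNIV (\<lambda>x :: (complex^'m^'n) \<times> (complex^'m). fst x *v snd x)"
    unfolding matrix_vector_mult_def by (intro continuous_intros)
qed

lemma bounded_linear_matrix_vector_mult:
  "bounded_linear (\<lambda>v. (A :: complex^'m^'n) *v v)"
proof -
  have "linear (\<lambda>v. A *v v)"
    by (intro linearI) (auto simp: vec_eq_iff matrix_vector_mult_def scaleR_sum_right algebra_simps sum.distrib)
  then show ?thesis by (rule linear_conv_bounded_linear[THEN iffD1])
qed

text \<open>The integrand of the modular with \<open>\<rho> x v\<close> replaced by the Euclidean
  norm of \<open>W x *v v\<close>. As an explicit formula it becomes jointly Borel in
  \<open>x\<close> and \<open>v\<close> once \<open>W\<close> and \<open>q\<close> are replaced by
  Borel versions.\<close>

definition wpow :: "('x \<Rightarrow> complex^'d^'d) \<Rightarrow> ('x \<Rightarrow> real) \<Rightarrow> 'x \<Rightarrow> complex^'d \<Rightarrow> ennreal" where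
  "wpow W q x v = ennreal (norm (W x *v v) powr q x)"

lemma wpow_measurable [measurable (raw)]:
  assumes [measurable]: "W \<in> borel_measurable M" "q \<in> borel_measurable M" "f \<in> borel_measurable M"
  shows "(\<lambda>x. wpow W q x (f x)) \<in> borel_measurable M"
  unfolding wpow_def by measurable

lemma wpow_zero [simp]: "wpow W q x 0 = 0"
  by (simp add: wpow_def)

lemma wpow_minus [simp]: "wpow W q x (- v) = wpow W q x v"
  using linear_neg[OF bounded_linear.linear[OF bounded_linear_matrix_vector_mult[of "W x"]]] by (simp add: wpow_def)

lemma wpow_minus_commute: "wpow W q x (u - v) = wpow W q x (v - u)"
  using wpow_minus[of W q x "u - v"] by simp

text \<open>The norm of the sum is at most three times the largest of the three norms, and the power
  of the largest is one of the three powers. The bound \<open>P\<close> on the exponent makes the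
  constant independent of \<open>x\<close>.\<close>

lemma wpow_add3_le:
  assumes q: "1 \<le> q x" "q x \<le> P"
  shows "wpow W q x (u + v + w) \<le> ennreal (3 powr P) * (wpow W q x u + wpow W q x v + wpow W q x w)"
proof -
  define a b c where "a = norm (W x *v u)" "b = norm (W x *v v)" "c = norm (W x *v w)"
  note abc = this
  define m where "m = max a (max b c)"
  have nonneg: "0 \<le> a" "0 \<le> b" "0 \<le> c" by (auto simp: abc)
  have "norm (W x *v (u + v + w)) \<le> a + b + c"
    unfolding abc by (simp add: matrix_vector_right_distrib) (meson add_right_mono norm_triangle_ineq order_trans)
  also have "\<dots> \<le> 3 * m" by (auto simp: m_def)
  finally have "norm (W x *v (u + v + w)) powr q x \<le> (3 * m) powr q x"
    using q by (intro powr_mono2) auto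
  also have "\<dots> = 3 powr q x * m powr q x"
    using nonneg by (subst powr_mult) (auto simp: m_def)
  also have "\<dots> \<le> 3 powr P * (a powr q x + b powr q x + c powr q x)"
    using q by (intro mult_mono powr_mono) (auto simp: m_def max_def add_nonneg_nonneg)
  finally have "wpow W q x (u + v + w) \<le> ennreal (3 powr P * (a powr q x + b powr q x + c powr q x))"
    unfolding wpow_def by (rule ennreal_leI)
  also have "\<dots> = ennreal (3 powr P) * (wpow W q x u + wpow W q x v + wpow W q x w)"
    by (simp add: wpow_def abc ennreal_mult ennreal_plus)
  finally show ?thesis .
qed

text \<open>For \<open>norm v \<le> 1\<close> and exponent at least 1, the power of
  \<open>norm v\<close> is at most \<open>norm v\<close> itself. The power of
  \<open>op_norm (W x)\<close> is at most 1 or at most its \<open>P\<close>-th power, according to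
  whether the base exceeds 1. The result is linear in \<open>norm v\<close> with a majorant free of
  \<open>v\<close>.\<close>

lemma wpow_le_norm:
  assumes q: "1 \<le> q x" "q x \<le> P" and v: "norm v \<le> 1"
  shows "wpow W q x v \<le> ennreal (norm v) * ennreal (1 + op_norm (W x) powr P)"
proof -
  let ?a = "op_norm (W x)"
  have a: "0 \<le> ?a" unfolding op_norm_def by (rule onorm_pos_le[OF bounded_linear_matrix_vector_mult])
  have "norm (W x *v v) powr q x \<le> (?a * norm v) powr q x"
    unfolding op_norm_def using q by (intro powr_mono2 onorm[OF bounded_linear_matrix_vector_mult]) auto
  also have "\<dots> = ?a powr q x * norm v powr q x"
    using a by (simp add: powr_mult)
  also have "\<dots> \<le> (1 + ?a powr P) * norm v"
  proof (rule mult_mono)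
    show "?a powr q x \<le> 1 + ?a powr P"
    proof (cases "?a \<le> 1")
      case True
      then have "?a powr q x \<le> 1" using a q by (intro powr_le1) auto
      then show ?thesis by (smt (verit) powr_ge_zero)
    next
      case False
      then have "?a powr q x \<le> ?a powr P" using q by (intro powr_mono) auto
      then show ?thesis by simp
    qed
    have "norm v powr q x \<le> norm v powr 1"
      using powr_mono'[of 1 "q x" "norm v"] q v by simp
    then show "norm v powr q x \<le> norm v" by simp
  qed auto
  finally show ?thesis
    unfolding wpow_def by (subst ennreal_mult[symmetric]) (auto simp: mult.commute add_nonneg_nonneg intro!: ennreal_leI)
qed

section \<open>Approximation by cellwise constants\<close>

lemma cellwise_constant_approximation:
  fixes W :: "real^'n \<Rightarrow> complex^'d^'d" and f :: "real^'n \<Rightarrow> complex^'d"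
  assumes meas: "W \<in> borel_measurable lebesgue" "q \<in> borel_measurable lebesgue" "f \<in> borel_measurable lebesgue"
    and d: "0 < d" and S: "finite S"
    and le: "\<And>y. y \<in> box (\<chi> i. - d) (\<chi> i. d) \<Longrightarrow> (\<integral>\<^sup>+x. wpow W q x (f (x - y) - f x) \<partial>lebesgue) \<le> e"
  shows "\<exists>v. (\<Sum>k\<in>S. \<integral>\<^sup>+x\<in>cell d k. wpow W q x (f x - v k) \<partial>lebesgue) \<le> 2 ^ CARD('n) * e"
proof -
  obtain W' q' f' where borel [measurable]: "W' \<in> borel_measurable borel" "q' \<in> borel_measurable borel" "f' \<in> borel_measurable borel"
    and ae: "AE x in lebesgue. W x = W' x" "AE x in lebesgue. q x = q' x" "AE x in lebesgue. f x = f' x"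
    using lebesgue_ex_borel_measurable[OF meas(1)] lebesgue_ex_borel_measurable[OF meas(2)]
      lebesgue_ex_borel_measurable[OF meas(3)] by (elim bexE) (rule that)
  \<comment> \<open>Only \<open>f\<close> is sampled at \<open>z\<close>, while weight and exponent
    stay at \<open>x\<close>; hence \<open>H x (x - y)\<close> is the integrand of the translation
    difference.\<close>
  define H where "H x z = wpow W' q' x (f' x - f' z)" for x z
  let ?B = "box (\<chi> i. - d) (\<chi> i. d) :: (real^'n) set"
  have "\<exists>z. (\<forall>k\<in>S. z k \<in> cell d k) \<and> ennreal (d ^ CARD('n)) *
      (\<Sum>k\<in>S. \<integral>\<^sup>+x\<in>cell d k. H x (z k) \<partial>lborel) \<le> emeasure lborel ?B * e"
  proof (rule sample_points)
    have "(\<lambda>p. H (fst p) (snd p)) \<in> borel_measurable (borel \<Otimes>\<^sub>M borel)"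
      unfolding H_def wpow_def by measurable
    then show "(\<lambda>(x, z). H x z) \<in> borel_measurable borel"
      by (simp add: borel_prod case_prod_beta')
    show "(\<integral>\<^sup>+x. H x (x - y) \<partial>lborel) \<le> e" if y: "y \<in> ?B" for y
    proof -
      have "(\<integral>\<^sup>+x. H x (x - y) \<partial>lborel) = (\<integral>\<^sup>+x. H x (x - y) \<partial>lebesgue)"
        by (simp add: nn_integral_completion)
      also have "\<dots> = (\<integral>\<^sup>+x. wpow W q x (f (x - y) - f x) \<partial>lebesgue)"
      proof (rule nn_integral_cong_AE)
        \<comment> \<open>Two exceptional sets for \<open>f\<close> occur here, one at
          \<open>x\<close> and one at \<open>x - y\<close>; the latter is a translate.\<close>
        show "AE x in lebesgue. H x (x - y) = wpow W q x (f (x - y) - f x)"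
          using ae AE_lebesgue_translation[OF ae(3), of y]
        proof eventually_elim
          case (elim x)
          then show ?case unfolding H_def by (subst wpow_minus_commute) (simp add: wpow_def)
        qed
      qed
      finally show ?thesis using le[OF y] by simp
    qed
  qed (use d S in \<open>simp_all add: emeasure_cell disjoint_cells cell_diff_mem_box\<close>)
  then obtain z where z: "ennreal (d ^ CARD('n)) *
      (\<Sum>k\<in>S. \<integral>\<^sup>+x\<in>cell d k. H x (z k) \<partial>lborel) \<le> emeasure lborel ?B * e"
    by blast
  let ?s = "\<Sum>k\<in>S. \<integral>\<^sup>+x\<in>cell d k. H x (z k) \<partial>lborel"
  \<comment> \<open>The box has side \<open>2 * d\<close> and each cell has side \<open>d\<close>,
    so the ratio of the volumes does not depend on the mesh.\<close>
  have "emeasure lborel ?B * e = ennreal (d ^ CARD('n)) * (2 ^ CARD('n) * e)"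
    using d ennreal_power[of 2 "CARD('n)"]
    by (simp add: emeasure_centered_box power_mult_distrib ennreal_mult mult_ac)
  then have "?s \<le> 2 ^ CARD('n) * e"
    using z d by (simp add: ennreal_mult_le_mult_iff)
  moreover have "(\<integral>\<^sup>+x\<in>cell d k. wpow W q x (f x - f' (z k)) \<partial>lebesgue) = (\<integral>\<^sup>+x\<in>cell d k. H x (z k) \<partial>lborel)" for k
  proof -
    have "(\<integral>\<^sup>+x\<in>cell d k. H x (z k) \<partial>lborel) = (\<integral>\<^sup>+x\<in>cell d k. H x (z k) \<partial>lebesgue)"
      by (simp add: nn_integral_completion)
    also have "\<dots> = (\<integral>\<^sup>+x\<in>cell d k. wpow W q x (f x - f' (z k)) \<partial>lebesgue)"
    proof (rule nn_integral_cong_AE)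
      show "AE x in lebesgue. H x (z k) * indicator (cell d k) x
          = wpow W q x (f x - f' (z k)) * indicator (cell d k) x"
        using ae
      proof eventually_elim
        case (elim x)
        then show ?case by (simp add: H_def wpow_def)
      qed
    qed
    finally show ?thesis by simp
  qed
  \<comment> \<open>The constants are values of the Borel version \<open>f'\<close>, which may
    differ from \<open>f\<close> at the sample points. This is harmless, since they serve only as
    constants.\<close>
  ultimately show ?thesis by (intro exI[of _ "\<lambda>k. f' (z k)"]) simp
qed

text \<open>For an injective matrix weight, \<open>norm v \<le> N * norm (W x *v v)\<close> holds for all \<open>v\<close> on a subset
  of \<open>Q\<close> of positive measure when \<open>N\<close> is large; there the modular grows at least linearly in \<open>v\<close>.\<close>
lemma bounded_sublevel_modular:
  fixes W :: "real^'n \<Rightarrow> complex^'d^'d"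
  assumes meas [measurable]: "W \<in> borel_measurable lebesgue" "q \<in> borel_measurable lebesgue"
      "Q \<in> sets lebesgue"
    and inj: "\<And>x v. W x *v v = 0 \<Longrightarrow> v = 0" and q: "\<And>x. 1 \<le> q x"
    and Q: "emeasure lebesgue Q \<noteq> 0" "emeasure lebesgue Q \<noteq> \<infinity>" and C: "C < \<infinity>"
  shows "bounded {v. (\<integral>\<^sup>+x\<in>Q. wpow W q x v \<partial>lebesgue) \<le> C}"
proof -
  \<comment> \<open>Testing only a countable dense set of vectors makes each \<open>E N\<close>
    measurable; continuity in \<open>v\<close> then recovers the inequality for all vectors.\<close>
  obtain D :: "(complex^'d) set" where D: "countable D" "\<And>X. open X \<Longrightarrow> X \<noteq> {} \<Longrightarrow> \<exists>d\<in>D. d \<in> X"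
    using countable_dense_setE by blast
  define E where "E N = {x \<in> Q. \<forall>v\<in>D. norm v \<le> real N * norm (W x *v v)}" for N :: nat
  have E_sets [measurable]: "E N \<in> sets lebesgue" for N
  proof -
    have "{x \<in> space lebesgue. x \<in> Q \<and> (\<forall>v\<in>D. norm v \<le> real N * norm (W x *v v))} \<in> sets lebesgue"
      using D(1) by (intro sets.sets_Collect_conj sets.sets_Collect_countable_Ball) measurable
    then show ?thesis by (simp add: E_def)
  qed
  have E_all: "norm v \<le> real N * norm (W x *v v)" if "x \<in> E N" for x v N
  proof -
    let ?G = "{v. norm v \<le> real N * norm (W x *v v)}"
    have "continuous_on UNIV (\<lambda>v. W x *v v)"
      by (rule linear_continuous_on[OF bounded_linear_matrix_vector_mult])
    then have "closed ?G" by (intro closed_Collect_le continuous_intros)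
    moreover have "D \<subseteq> ?G" using that by (auto simp: E_def)
    ultimately have "?G = UNIV" using D(2)[of "- ?G"] by (auto simp: open_Compl)
    then show ?thesis by blast
  qed
  \<comment> \<open>At each fixed \<open>x\<close> an injective linear map in finite dimension is
    bounded below, though with a constant depending on \<open>x\<close>. Some \<open>E N\<close>
    therefore has positive measure.\<close>
  have "Q \<subseteq> (\<Union>N. E N)"
  proof
    fix x assume x: "x \<in> Q"
    let ?f = "\<lambda>v. W x *v v"
    have lin: "linear ?f" by (rule bounded_linear.linear[OF bounded_linear_matrix_vector_mult])
    have "inj ?f" using inj by (simp add: linear_injective_0[OF lin])
    then obtain B where B: "0 < B" "\<And>v. B * norm v \<le> norm (W x *v v)"
      using linear_inj_bounded_below_pos[OF lin] by auto
    obtain N :: nat where N: "1 / B \<le> real N" using real_arch_simple by blast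
    have "norm v \<le> real N * norm (W x *v v)" for v
    proof -
      have "norm v \<le> 1 / B * norm (W x *v v)" using B by (simp add: field_simps)
      also have "\<dots> \<le> real N * norm (W x *v v)" using N by (intro mult_right_mono) auto
      finally show ?thesis .
    qed
    then show "x \<in> (\<Union>N. E N)" using x by (auto simp: E_def)
  qed
  then have "\<exists>N. emeasure lebesgue (E N) \<noteq> 0"
  proof (rule contrapos_pp)
    assume "\<not> (\<exists>N. emeasure lebesgue (E N) \<noteq> 0)"
    then have "emeasure lebesgue (\<Union>N. E N) = 0"
      using E_sets by (intro emeasure_UN_eq_0) auto
    moreover have "(\<Union>N. E N) \<in> sets lebesgue" by measurable
    ultimately show "\<not> Q \<subseteq> (\<Union>N. E N)" using Q(1) emeasure_eq_0 by metis
  qed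
  then obtain N where N: "emeasure lebesgue (E N) \<noteq> 0" by blast
  define m where "m = measure lebesgue (E N)"
  have "emeasure lebesgue (E N) \<le> emeasure lebesgue Q"
    by (intro emeasure_mono) (auto simp: E_def)
  then have fin: "emeasure lebesgue (E N) \<noteq> \<infinity>" using Q(2) by (auto simp: top_unique)
  then have em: "emeasure lebesgue (E N) = ennreal m"
    by (simp add: m_def emeasure_eq_ennreal_measure)
  with N have m: "0 < m" by (auto simp: m_def zero_less_measure_iff)
  obtain c where c: "C = ennreal c" "0 \<le> c" using C by (cases C) auto
  have "norm v \<le> max (real N) (real N * c / m)"
    if v: "(\<integral>\<^sup>+x\<in>Q. wpow W q x v \<partial>lebesgue) \<le> C" for v
  proof (cases "norm v \<le> real N")
    case False
    have "N \<noteq> 0"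
    proof
      assume "N = 0"
      moreover obtain x where "x \<in> E N" using N by fastforce
      ultimately have "norm v \<le> 0" using E_all[of x N v] by simp
      then show False using False by simp
    qed
    then have "0 < real N" by simp
    \<comment> \<open>On \<open>E N\<close> the norm of \<open>W x *v v\<close> is at least
      \<open>norm v / real N\<close>, which is at least 1 in this case, so raising to a power
      \<open>q x \<ge> 1\<close> does not decrease it.\<close>
    have le: "ennreal (norm v / real N) * indicator (E N) x \<le> wpow W q x v * indicator Q x" for x
    proof (cases "x \<in> E N")
      case True
      let ?a = "norm (W x *v v)"
      have a: "norm v / real N \<le> ?a" using E_all[OF True, of v] \<open>0 < real N\<close> by (simp add: field_simps)
      have "1 \<le> norm v / real N" using False \<open>0 < real N\<close> by simp
      then have "1 \<le> ?a" using a by simp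
      then have "?a \<le> ?a powr q x" using powr_mono[of 1 "q x" ?a] q[of x] by simp
      with a have "norm v / real N \<le> ?a powr q x" by simp
      then show ?thesis using True by (auto simp: E_def wpow_def intro: ennreal_leI)
    qed simp
    have "ennreal (norm v / real N * m) = (\<integral>\<^sup>+x. ennreal (norm v / real N) * indicator (E N) x \<partial>lebesgue)"
      using m by (simp add: nn_integral_cmult_indicator em flip: ennreal_mult)
    also have "\<dots> \<le> (\<integral>\<^sup>+x\<in>Q. wpow W q x v \<partial>lebesgue)"
      by (intro nn_integral_mono le)
    also have "\<dots> \<le> ennreal c" using v c by simp
    finally have "norm v / real N * m \<le> c" using c by simp
    then have "norm v \<le> real N * c / m" using m \<open>0 < real N\<close> by (simp add: field_simps)
    then show ?thesis by simp
  qed simp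
  then show ?thesis by (auto simp: bounded_iff)
qed

text \<open>Off \<open>A\<close>, the difference at a point of \<open>Q k\<close> passes through the
  constants \<open>u k\<close> and \<open>v k\<close>; on \<open>A\<close> it is split as
  \<open>f x + 0 + (- g x)\<close>. Both cases use the three-term inequality
  \<open>wpow_add3_le\<close>.\<close>

lemma modular_diff_le:
  fixes W :: "'x \<Rightarrow> complex^'d^'d"
  assumes meas [measurable]: "W \<in> borel_measurable M" "q \<in> borel_measurable M"
      "f \<in> borel_measurable M" "g \<in> borel_measurable M"
    and q: "\<And>x. 1 \<le> q x" "\<And>x. q x \<le> P"
    and S: "finite S" and Q: "\<And>k. k \<in> S \<Longrightarrow> Q k \<in> sets M"
    and A [measurable]: "A \<in> sets M" and cover: "\<And>x. x \<notin> A \<Longrightarrow> \<exists>k\<in>S. x \<in> Q k"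
  shows "(\<integral>\<^sup>+x. wpow W q x (f x - g x) \<partial>M) \<le> ennreal (3 powr P) *
    ((\<Sum>k\<in>S. \<integral>\<^sup>+x\<in>Q k. wpow W q x (f x - u k) \<partial>M) + (\<Sum>k\<in>S. \<integral>\<^sup>+x\<in>Q k. wpow W q x (u k - v k) \<partial>M)
      + (\<Sum>k\<in>S. \<integral>\<^sup>+x\<in>Q k. wpow W q x (g x - v k) \<partial>M)
      + (\<integral>\<^sup>+x\<in>A. wpow W q x (f x) \<partial>M) + (\<integral>\<^sup>+x\<in>A. wpow W q x (g x) \<partial>M))"
proof -
  let ?w = "wpow W q"
  have Q_meas [measurable]: "(\<lambda>x. \<Sum>k\<in>S. h k x * indicator (Q k) x) \<in> borel_measurable M"
    if "\<And>k. h k \<in> borel_measurable M" for h :: "_ \<Rightarrow> 'x \<Rightarrow> ennreal"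
    using that Q by (intro borel_measurable_sum borel_measurable_times_ennreal borel_measurable_indicator) auto
  have sum_eq: "(\<integral>\<^sup>+x. (\<Sum>k\<in>S. h k x * indicator (Q k) x) \<partial>M) = (\<Sum>k\<in>S. \<integral>\<^sup>+x\<in>Q k. h k x \<partial>M)"
    if "\<And>k. h k \<in> borel_measurable M" for h :: "_ \<Rightarrow> 'x \<Rightarrow> ennreal"
    using that Q by (intro nn_integral_sum borel_measurable_times_ennreal borel_measurable_indicator) auto
  let ?s1 = "\<lambda>x. \<Sum>k\<in>S. ?w x (f x - u k) * indicator (Q k) x"
  let ?s2 = "\<lambda>x. \<Sum>k\<in>S. ?w x (u k - v k) * indicator (Q k) x"
  let ?s3 = "\<lambda>x. \<Sum>k\<in>S. ?w x (g x - v k) * indicator (Q k) x"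
  let ?a1 = "\<lambda>x. ?w x (f x) * indicator A x"
  let ?a2 = "\<lambda>x. ?w x (g x) * indicator A x"
  have le: "?w x (f x - g x) \<le> ennreal (3 powr P) * (?s1 x + ?s2 x + ?s3 x + ?a1 x + ?a2 x)" for x
  proof (cases "x \<in> A")
    case True
    have "?w x (f x - g x) \<le> ennreal (3 powr P) * (?w x (f x) + ?w x 0 + ?w x (- g x))"
      using wpow_add3_le[of q x P W "f x" 0 "- g x"] q by simp
    also have "\<dots> = ennreal (3 powr P) * (?a1 x + ?a2 x)" using True by simp
    also have "\<dots> \<le> ennreal (3 powr P) * (?s1 x + ?s2 x + ?s3 x + (?a1 x + ?a2 x))"
      by (rule mult_left_mono) simp_all
    finally show ?thesis by (simp add: add.assoc)
  next
    case False
    then obtain k where k: "k \<in> S" "x \<in> Q k" using cover by blast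
    have mem: "h k \<le> (\<Sum>k\<in>S. h k * indicator (Q k) x)" for h :: "_ \<Rightarrow> ennreal"
      using member_le_sum[of k S "\<lambda>k. h k * indicator (Q k) x"] k S by simp
    have "?w x (f x - g x) = ?w x ((f x - u k) + (u k - v k) + (v k - g x))" by simp
    also have "\<dots> \<le> ennreal (3 powr P) * (?w x (f x - u k) + ?w x (u k - v k) + ?w x (v k - g x))"
      using q by (intro wpow_add3_le) auto
    also have "?w x (v k - g x) = ?w x (g x - v k)" by (rule wpow_minus_commute)
    also have "ennreal (3 powr P) * (?w x (f x - u k) + ?w x (u k - v k) + ?w x (g x - v k))
        \<le> ennreal (3 powr P) * (?s1 x + ?s2 x + ?s3 x)"
      by (intro mult_left_mono add_mono mem) simp
    also have "\<dots> \<le> ennreal (3 powr P) * (?s1 x + ?s2 x + ?s3 x + (?a1 x + ?a2 x))"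
      by (intro mult_left_mono) simp_all
    finally show ?thesis by (simp add: add.assoc)
  qed
  have "(\<integral>\<^sup>+x. ?w x (f x - g x) \<partial>M)
      \<le> (\<integral>\<^sup>+x. ennreal (3 powr P) * (?s1 x + ?s2 x + ?s3 x + ?a1 x + ?a2 x) \<partial>M)"
    by (intro nn_integral_mono le)
  also have "\<dots> = ennreal (3 powr P) * ((\<integral>\<^sup>+x. ?s1 x \<partial>M) + (\<integral>\<^sup>+x. ?s2 x \<partial>M) + (\<integral>\<^sup>+x. ?s3 x \<partial>M)
      + (\<integral>\<^sup>+x. ?a1 x \<partial>M) + (\<integral>\<^sup>+x. ?a2 x \<partial>M))"
    by (simp add: nn_integral_cmult nn_integral_add Q_meas)
  finally show ?thesis by (simp add: sum_eq)
qed

text \<open>Integrating \<open>wpow_le_norm\<close> over \<open>Q\<close> gives the linear bound,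
  with \<open>b\<close> the integral of the majorant. This is the point where integrability of the
  \<open>P\<close>-th power of the operator norm enters.\<close>

lemma modular_const_le:
  assumes q: "\<And>x. 1 \<le> q x" "\<And>x. q x \<le> P"
    and Q: "Q \<in> sets M" "emeasure M Q \<noteq> \<infinity>"
    and int: "set_integrable M Q (\<lambda>x. op_norm (W x) powr P)"
  shows "\<exists>b\<ge>0. \<forall>v. norm v \<le> 1 \<longrightarrow> (\<integral>\<^sup>+x\<in>Q. wpow W q x v \<partial>M) \<le> ennreal (norm v * b)"
proof -
  let ?g = "\<lambda>x. indicator Q x *\<^sub>R (1 + op_norm (W x) powr P)"
  have int1: "integrable M ?g"
    using int Q unfolding set_integrable_def scaleR_add_right
    by (intro Bochner_Integration.integrable_add) (auto simp: less_top)
  have pos: "0 \<le> ?g x" for x by (simp add: indicator_def)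
  have "(\<integral>\<^sup>+x\<in>Q. wpow W q x v \<partial>M) \<le> ennreal (norm v * (\<integral>x. ?g x \<partial>M))" if v: "norm v \<le> 1" for v
  proof -
    have "(\<integral>\<^sup>+x\<in>Q. wpow W q x v \<partial>M) \<le> (\<integral>\<^sup>+x. ennreal (norm v * ?g x) \<partial>M)"
      using wpow_le_norm[where q = q and W = W and P = P, OF q v]
      by (intro nn_integral_mono) (auto simp: indicator_def ennreal_mult add_nonneg_nonneg)
    also have "\<dots> = ennreal (norm v * (\<integral>x. ?g x \<partial>M))"
      using int1 pos by (subst nn_integral_eq_integral) (auto intro!: mult_nonneg_nonneg AE_I2)
    finally show ?thesis .
  qed
  moreover have "0 \<le> (\<integral>x. ?g x \<partial>M)" using pos by (intro integral_nonneg_AE) auto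
  ultimately show ?thesis by (intro exI[of _ "\<integral>x. ?g x \<partial>M"]) simp
qed

section \<open>Total boundedness\<close>

text \<open>Round each value \<open>v f k\<close> to a point of a finite
  \<open>\<eta> / 2\<close>-net \<open>T\<close>. Finitely many rounding patterns from
  \<open>S\<close> to \<open>T\<close> exist, and members with the same pattern are
  \<open>\<eta>\<close>-close on \<open>S\<close>. One representative per occurring pattern keeps
  the centres inside \<open>F\<close>.\<close>

lemma finite_net_of_bounded_family:
  fixes v :: "'f \<Rightarrow> 'k \<Rightarrow> 'b::euclidean_space"
  assumes S: "finite S" and V: "bounded V" "\<And>f k. f \<in> F \<Longrightarrow> k \<in> S \<Longrightarrow> v f k \<in> V" and \<eta>: "0 < \<eta>"
  shows "\<exists>G. finite G \<and> G \<subseteq> F \<and> (\<forall>f\<in>F. \<exists>g\<in>G. \<forall>k\<in>S. norm (v f k - v g k) < \<eta>)"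
proof -
  have "compact (closure V)" using V(1) by (simp add: compact_closure)
  moreover have "0 < \<eta> / 2" using \<eta> by simp
  ultimately obtain T where T: "finite T" "closure V \<subseteq> (\<Union>x\<in>T. ball x (\<eta> / 2))"
    unfolding compact_eq_totally_bounded by blast
  have "\<forall>u\<in>V. \<exists>w. w \<in> T \<and> dist w u < \<eta> / 2"
    using T(2) closure_subset[of V] by fastforce
  from bchoice[OF this] obtain \<phi> where \<phi>: "\<And>u. u \<in> V \<Longrightarrow> \<phi> u \<in> T" "\<And>u. u \<in> V \<Longrightarrow> dist (\<phi> u) u < \<eta> / 2"
    by blast
  define \<Phi> where "\<Phi> f = restrict (\<lambda>k. \<phi> (v f k)) S" for f
  have "\<Phi> ` F \<subseteq> (S \<rightarrow>\<^sub>E T)" using V(2) \<phi>(1) by (auto simp: \<Phi>_def)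
  then have fin: "finite (\<Phi> ` F)" using S T(1) by (meson finite_PiE finite_subset)
  have near: "norm (v f k - v g k) < \<eta>" if fg: "f \<in> F" "g \<in> F" "\<Phi> g = \<Phi> f" and k: "k \<in> S" for f g k
  proof -
    have "\<phi> (v g k) = \<phi> (v f k)" using fun_cong[OF fg(3), of k] k by (simp add: \<Phi>_def)
    then show ?thesis
      using \<phi>(2)[OF V(2)[OF fg(1) k]] \<phi>(2)[OF V(2)[OF fg(2) k]]
        dist_triangle_half_r[of "\<phi> (v f k)" "v f k" \<eta> "v g k"] by (simp add: dist_norm)
  qed
  show ?thesis
  proof (intro exI conjI ballI)
    show "finite (inv_into F \<Phi> ` (\<Phi> ` F))" using fin by simp
    show "inv_into F \<Phi> ` (\<Phi> ` F) \<subseteq> F" by (auto intro: inv_into_into)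
    fix f assume f: "f \<in> F"
    show "\<exists>g\<in>inv_into F \<Phi> ` (\<Phi> ` F). \<forall>k\<in>S. norm (v f k - v g k) < \<eta>"
      using f by (intro bexI[of _ "inv_into F \<Phi> (\<Phi> f)"] ballI near)
        (auto intro: inv_into_into f_inv_into_f)
  qed
qed

text \<open>Because the exponents lie in \<open>[1, P]\<close>, dividing by \<open>t\<close> costs
  at most the factor \<open>max 1 ((1 / t) powr P)\<close>. A sufficiently small modular thus makes
  \<open>t\<close> admissible in the infimum defining the norm.\<close>

lemma lux_norm_leI:
  assumes t: "0 < t"
    and le: "AE x in lebesgue. ennreal (\<rho> x (f x) powr real_of_ereal (p x)) \<le> wpow W q x (f x)"
    and q: "AE x in lebesgue. real_of_ereal (p x) = q x" "\<And>x. 1 \<le> q x" "\<And>x. q x \<le> P"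
    and nonneg: "\<And>x v. 0 \<le> \<rho> x v"
    and meas [measurable]: "W \<in> borel_measurable lebesgue" "q \<in> borel_measurable lebesgue"
      "f \<in> borel_measurable lebesgue"
    and mod: "ennreal (max 1 ((1 / t) powr P)) * (\<integral>\<^sup>+x. wpow W q x (f x) \<partial>lebesgue) \<le> 1"
  shows "lux_norm p \<rho> f \<le> t"
proof -
  let ?L = "max 1 ((1 / t) powr P)"
  have L: "(1 / t) powr q x \<le> ?L" for x
  proof (cases "1 / t \<le> 1")
    case True
    then have "(1 / t) powr q x \<le> 1" using t q(2)[of x] by (intro powr_le1) auto
    then show ?thesis by simp
  next
    case False
    then have "(1 / t) powr q x \<le> (1 / t) powr P" using q(3)[of x] by (intro powr_mono) auto
    then show ?thesis by simp
  qed
  have "(\<integral>\<^sup>+x. ennreal ((\<rho> x (f x) / t) powr real_of_ereal (p x)) \<partial>lebesgue)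
      \<le> (\<integral>\<^sup>+x. ennreal ?L * wpow W q x (f x) \<partial>lebesgue)"
  proof (rule nn_integral_mono_AE)
    show "AE x in lebesgue. ennreal ((\<rho> x (f x) / t) powr real_of_ereal (p x)) \<le> ennreal ?L * wpow W q x (f x)"
      using le q(1)
    proof eventually_elim
      case (elim x)
      have "(\<rho> x (f x) / t) powr q x = (1 / t) powr q x * \<rho> x (f x) powr q x"
        using t nonneg[of x "f x"] powr_mult[of "1 / t" "\<rho> x (f x)" "q x"] by simp
      also have "\<dots> \<le> ?L * \<rho> x (f x) powr q x" by (intro mult_right_mono L) simp
      finally have "ennreal ((\<rho> x (f x) / t) powr q x) \<le> ennreal ?L * ennreal (\<rho> x (f x) powr q x)"
        by (subst ennreal_mult[symmetric]) (auto intro: ennreal_leI)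
      also have "\<dots> \<le> ennreal ?L * wpow W q x (f x)"
        using elim by (intro mult_left_mono) auto
      finally show ?case using elim(2) by simp
    qed
  qed
  also have "\<dots> = ennreal ?L * (\<integral>\<^sup>+x. wpow W q x (f x) \<partial>lebesgue)"
    by (rule nn_integral_cmult) measurable
  also have "\<dots> \<le> 1" by (rule mod)
  finally show ?thesis
    unfolding lux_norm_def using t by (intro cInf_lower bdd_belowI[of _ 0]) auto
qed

theorem theorem3p2:
  fixes p :: "real^'n \<Rightarrow> ereal"
    and \<rho> :: "real^'n \<Rightarrow> complex^'d \<Rightarrow> real"
    and W :: "real^'n \<Rightarrow> complex^'d^'d"
    and F :: "(real^'n \<Rightarrow> complex^'d) set"
  assumes p_meas: "p \<in> borel_measurable lebesgue"
    and p_range: "\<And>x. 1 \<le> p x"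
    and p_plus: "esssup lebesgue p < \<infinity>"
    and rho_norm: "\<And>x. is_cnorm (\<rho> x)"
    and rho_meas: "\<And>f. f \<in> borel_measurable lebesgue \<Longrightarrow>
                        (\<lambda>x. \<rho> x (f x)) \<in> borel_measurable lebesgue"
    and W_pd: "\<And>x. self_adjoint (W x) \<and> pos_def (W x)"
    and W_equiv: "\<And>x v. \<rho> x v \<le> norm (W x *v v)
                      \<and> norm (W x *v v) \<le> sqrt (real CARD('d)) * \<rho> x v"
    and W_weight: "invertible_matrix_weight W"
    and W_loc: "loc_integrable (\<lambda>x. op_norm (W x) powr real_of_ereal (esssup lebesgue p))"
    and F_sub: "F \<subseteq> Lpvar p \<rho>"
    and cond_a: "(SUP f\<in>F. modular p \<rho> f) < \<infinity>"
    and cond_b: "((\<lambda>R. SUP f\<in>F. modular_on p \<rho> (- ball 0 R) f) \<longlongrightarrow> 0) at_top"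
    and cond_c: "((\<lambda>r. SUP f\<in>F. SUP y\<in>ball 0 r. modular p \<rho> (\<lambda>x. f (x - y) - f x))
                  \<longlongrightarrow> 0) (at_right 0)"
  shows "lux_totally_bounded p \<rho> F"
proof -
  define P where "P = real_of_ereal (esssup lebesgue p)"
  \<comment> \<open>Truncating the exponent to \<open>[1, P]\<close> gives bounds at every point. It
    changes \<open>p\<close> only on a null set, which takes care of the points where
    \<open>p\<close> is infinite or exceeds its essential supremum.\<close>
  define q where "q x = max 1 (min P (real_of_ereal (p x)))" for x
  let ?w = "wpow W q"
  \<comment> \<open>Together with \<open>p_plus\<close> this shows that the essential supremum is a
    real number, so that it equals \<open>ereal P\<close>.\<close>
  have sup_ge: "1 \<le> esssup lebesgue p"
  proof -
    have "1 = esssup lebesgue (\<lambda>x :: real^'n. 1 :: ereal)" by (rule esssup_const[symmetric]) simp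
    also have "\<dots> \<le> esssup lebesgue p" by (rule esssup_mono) (use p_range in auto)
    finally show ?thesis .
  qed
  then have P: "1 \<le> P" "esssup lebesgue p = ereal P"
    unfolding P_def using p_plus by (cases "esssup lebesgue p"; auto simp: one_ereal_def)+
  have q: "1 \<le> q x" "q x \<le> P" for x using P(1) by (auto simp: q_def)
  have pq: "AE x in lebesgue. real_of_ereal (p x) = q x"
    using esssup_AE[of p lebesgue]
  proof eventually_elim
    case (elim x)
    then show ?case using p_range[of x] P by (cases "p x") (auto simp: q_def one_ereal_def)
  qed
  have q_meas [measurable]: "q \<in> borel_measurable lebesgue"
    unfolding q_def using p_meas by measurable
  have W_meas [measurable]: "W \<in> borel_measurable lebesgue"
    using W_weight by (simp add: invertible_matrix_weight_def matrix_weight_def)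
  have F_meas: "f \<in> borel_measurable lebesgue" if "f \<in> F" for f
    using F_sub that by (auto simp: Lpvar_def)
  have rho_nonneg: "0 \<le> \<rho> x v" for x v using rho_norm[of x] by (simp add: is_cnorm_def)
  have W_inj: "v = 0" if "W x *v v = 0" for x v
    using W_pd[of x] that by (force simp: pos_def_def cinner_def)
  \<comment> \<open>The price of passing from \<open>\<rho>\<close> to \<open>W\<close> in the
    modular: the factor \<open>sqrt (real CARD('d))\<close> is at least 1 and is raised to an
    exponent at most \<open>P\<close>.\<close>
  define K where "K = sqrt (real CARD('d)) powr P"
  have K: "0 < K" by (simp add: K_def)
  have w_le: "(\<integral>\<^sup>+x\<in>A. ?w x (f x) \<partial>lebesgue) \<le> ennreal K * modular_on p \<rho> A f"
    if [measurable]: "f \<in> borel_measurable lebesgue" "A \<in> sets lebesgue" for f A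
  proof -
    have [measurable]: "(\<lambda>x. \<rho> x (f x)) \<in> borel_measurable lebesgue" by (rule rho_meas) measurable
    have "(\<integral>\<^sup>+x\<in>A. ?w x (f x) \<partial>lebesgue)
        \<le> (\<integral>\<^sup>+x. ennreal K * (ennreal (\<rho> x (f x) powr real_of_ereal (p x)) * indicator A x) \<partial>lebesgue)"
    proof (rule nn_integral_mono_AE)
      show "AE x in lebesgue. ?w x (f x) * indicator A x
          \<le> ennreal K * (ennreal (\<rho> x (f x) powr real_of_ereal (p x)) * indicator A x)"
        using pq
      proof eventually_elim
        case (elim x)
        let ?s = "sqrt (real CARD('d))"
        have "norm (W x *v f x) powr q x \<le> (?s * \<rho> x (f x)) powr q x"
          using W_equiv[of x "f x"] q(1)[of x] by (intro powr_mono2) auto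
        also have "\<dots> = ?s powr q x * \<rho> x (f x) powr q x"
          using rho_nonneg by (simp add: powr_mult)
        also have "\<dots> \<le> K * \<rho> x (f x) powr q x"
          unfolding K_def using q(2)[of x] by (intro mult_right_mono powr_mono) auto
        finally show ?case using elim K
          by (auto simp: wpow_def indicator_def ennreal_mult[symmetric] intro!: ennreal_leI)
      qed
    qed
    also have "\<dots> = ennreal K * modular_on p \<rho> A f"
      unfolding modular_on_def using p_meas by (subst nn_integral_cmult) auto
    finally show ?thesis .
  qed
  \<comment> \<open>The comparison in the other direction has constant 1.\<close>
  have rho_le_w: "AE x in lebesgue. ennreal (\<rho> x (g x) powr real_of_ereal (p x)) \<le> ?w x (g x)" for g
    using pq
  proof eventually_elim
    case (elim x)
    then show ?case
      unfolding wpow_def using W_equiv[of x "g x"] q(1)[of x] rho_nonneg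
      by (auto intro!: ennreal_leI powr_mono2)
  qed

  show ?thesis unfolding lux_totally_bounded_def
  proof (intro allI impI)
    fix e :: real assume e: "0 < e"
    \<comment> \<open>Halving leaves room for the strict inequality, as \<open>lux_norm_leI\<close>
      yields only a weak one.\<close>
    define t where "t = e / 2"
    have t: "0 < t" "t < e" using e by (auto simp: t_def)
    define L where "L = max 1 ((1 / t) powr P)"
    have L: "1 \<le> L" by (simp add: L_def)
    \<comment> \<open>Five error terms of size \<open>\<tau>\<close> will occur, multiplied by
      \<open>3 powr P\<close> from the splitting and by \<open>L\<close> from the passage to the
      Luxemburg norm.\<close>
    define \<tau> where "\<tau> = 1 / (5 * L * 3 powr P)"
    have \<tau>: "0 < \<tau>" using L by (simp add: \<tau>_def)
    have final: "ennreal L * (ennreal (3 powr P) * (ennreal \<tau> + ennreal \<tau> + ennreal \<tau> + ennreal \<tau> + ennreal \<tau>)) \<le> 1"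
    proof -
      have "ennreal \<tau> + ennreal \<tau> + ennreal \<tau> + ennreal \<tau> + ennreal \<tau> = ennreal (5 * \<tau>)"
        using \<tau> by (simp flip: ennreal_plus)
      then show ?thesis using \<tau> L by (simp add: \<tau>_def flip: ennreal_mult)
    qed

    obtain R where R: "\<And>f. f \<in> F \<Longrightarrow> modular_on p \<rho> (- ball 0 R) f \<le> ennreal (\<tau> / K)"
    proof -
      have "\<forall>\<^sub>F R in at_top. (SUP f\<in>F. modular_on p \<rho> (- ball 0 R) f) < ennreal (\<tau> / K)"
        using cond_b \<tau> K by (intro order_tendstoD(2)) auto
      from eventually_happens'[OF trivial_limit_at_top_linorder this]
      obtain R where R: "(SUP f\<in>F. modular_on p \<rho> (- ball 0 R) f) < ennreal (\<tau> / K)" ..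
      have "modular_on p \<rho> (- ball 0 R) f \<le> ennreal (\<tau> / K)" if "f \<in> F" for f
        using R SUP_upper[OF that, of "modular_on p \<rho> (- ball 0 R)"] by simp
      then show ?thesis by (rule that)
    qed
    \<comment> \<open>The divisor anticipates the factor \<open>2 ^ CARD('n)\<close> from sampling
      and the factor \<open>K\<close> from the change to \<open>W\<close>.\<close>
    let ?c = "\<tau> / (2 ^ CARD('n) * K)"
    obtain r where r: "0 < r" "\<And>f y. f \<in> F \<Longrightarrow> y \<in> ball 0 r \<Longrightarrow>
        modular p \<rho> (\<lambda>x. f (x - y) - f x) \<le> ennreal ?c"
    proof -
      have "\<forall>\<^sub>F r in at_right 0. (SUP f\<in>F. SUP y\<in>ball 0 r. modular p \<rho> (\<lambda>x. f (x - y) - f x)) < ennreal ?c"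
        using cond_c \<tau> K by (intro order_tendstoD(2)) auto
      then have "\<forall>\<^sub>F r :: real in at_right 0. 0 < r \<and>
          (SUP f\<in>F. SUP y\<in>ball 0 r. modular p \<rho> (\<lambda>x. f (x - y) - f x)) < ennreal ?c"
        by (intro eventually_conj eventually_at_right_less)
      from eventually_happens'[OF trivial_limit_at_right_real this] obtain r where
        "0 < r \<and> (SUP f\<in>F. SUP y\<in>ball 0 r. modular p \<rho> (\<lambda>x. f (x - y) - f x)) < ennreal ?c" ..
      then have r: "0 < r"
        "(SUP f\<in>F. SUP y\<in>ball 0 r. modular p \<rho> (\<lambda>x. f (x - y) - f x)) < ennreal ?c"
        by - (erule conjunct1, erule conjunct2)
      have "modular p \<rho> (\<lambda>x. f (x - y) - f x) \<le> ennreal ?c" if "f \<in> F" "y \<in> ball 0 r" for f y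
      proof -
        have "modular p \<rho> (\<lambda>x. f (x - y) - f x) \<le> (SUP y\<in>ball 0 r. modular p \<rho> (\<lambda>x. f (x - y) - f x))"
          using that(2) by (rule SUP_upper)
        also have "\<dots> \<le> (SUP f\<in>F. SUP y\<in>ball 0 r. modular p \<rho> (\<lambda>x. f (x - y) - f x))"
          using that(1) by (rule SUP_upper)
        finally show ?thesis using r(2) by simp
      qed
      with r(1) show ?thesis by (rule that)
    qed
    define d where "d = r / CARD('n)"
    have d: "0 < d" "real CARD('n) * d \<le> r" using r(1) by (auto simp: d_def)
    obtain S :: "('n \<Rightarrow> int) set" where S: "finite S" "ball 0 R \<subseteq> (\<Union>k\<in>S. cell d k)"
      using finite_cells_cover_ball[OF d(1)] by blast
    have cell_meas [measurable]: "cell d k \<in> sets lebesgue" for k :: "'n \<Rightarrow> int" by simp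

    have "\<exists>v. (\<Sum>k\<in>S. \<integral>\<^sup>+x\<in>cell d k. ?w x (f x - v k) \<partial>lebesgue) \<le> ennreal \<tau>" if f: "f \<in> F" for f
    proof -
      note [measurable] = F_meas[OF f]
      have "(\<integral>\<^sup>+x. ?w x (f (x - y) - f x) \<partial>lebesgue) \<le> ennreal (\<tau> / 2 ^ CARD('n))"
        if y: "y \<in> box (\<chi> i. - d) (\<chi> i. d)" for y
      proof -
        have [measurable]: "(\<lambda>x. f (x - y)) \<in> borel_measurable lebesgue"
          by (rule measurable_compose[OF lebesgue_translation_measurable F_meas[OF f]])
        have "(\<integral>\<^sup>+x. ?w x (f (x - y) - f x) \<partial>lebesgue) \<le> ennreal K * modular p \<rho> (\<lambda>x. f (x - y) - f x)"
          using w_le[of "\<lambda>x. f (x - y) - f x" UNIV] by simp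
        also have "\<dots> \<le> ennreal K * ennreal ?c"
          using centered_box_subset_ball[OF d] y by (intro mult_left_mono r(2)[OF f]) auto
        also have "\<dots> = ennreal (\<tau> / 2 ^ CARD('n))"
          using K \<tau> by (subst ennreal_mult[symmetric]) auto
        finally show ?thesis .
      qed
      from cellwise_constant_approximation[OF W_meas q_meas F_meas[OF f] d(1) S(1) this]
      have "\<exists>v. (\<Sum>k\<in>S. \<integral>\<^sup>+x\<in>cell d k. ?w x (f x - v k) \<partial>lebesgue) \<le> 2 ^ CARD('n) * ennreal (\<tau> / 2 ^ CARD('n))" .
      moreover have "2 ^ CARD('n) * ennreal (\<tau> / 2 ^ CARD('n)) = ennreal \<tau>"
        using ennreal_mult[of "2 ^ CARD('n)" "\<tau> / 2 ^ CARD('n)"] ennreal_power[of 2 "CARD('n)"] \<tau> by simp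
      ultimately show ?thesis by simp
    qed
    then have "\<forall>f\<in>F. \<exists>v. (\<Sum>k\<in>S. \<integral>\<^sup>+x\<in>cell d k. ?w x (f x - v k) \<partial>lebesgue) \<le> ennreal \<tau>" by blast
    from bchoice[OF this] obtain v where
      v: "\<And>f. f \<in> F \<Longrightarrow> (\<Sum>k\<in>S. \<integral>\<^sup>+x\<in>cell d k. ?w x (f x - v f k) \<partial>lebesgue) \<le> ennreal \<tau>"
      by blast

    define M where "M = (SUP f\<in>F. modular p \<rho> f)"
    \<comment> \<open>A bound, uniform over \<open>F\<close> and the cells, for the modular of a
      sampled constant: the constant is the sum of its deviation from \<open>f\<close>, controlled
      by \<open>\<tau>\<close>, and \<open>f\<close> itself, controlled by (a).\<close>
    define C where "C = ennreal (3 powr P) * (ennreal \<tau> + ennreal K * M)"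
    have C: "C < \<infinity>" using cond_a by (auto simp: C_def M_def ennreal_mult_less_top)
    define V where "V = (\<Union>k\<in>S. {u. (\<integral>\<^sup>+x\<in>cell d k. ?w x u \<partial>lebesgue) \<le> C})"
    have V: "bounded V" unfolding V_def
    proof (intro bounded_UN ballI S(1))
      fix k :: "'n \<Rightarrow> int"
      have em: "emeasure lebesgue (cell d k) = ennreal (d ^ CARD('n))"
        using emeasure_cell[OF d(1), of k] by simp
      show "bounded {u. (\<integral>\<^sup>+x\<in>cell d k. ?w x u \<partial>lebesgue) \<le> C}"
      proof (rule bounded_sublevel_modular[OF W_meas q_meas cell_meas _ q(1) _ _ C])
        show "u = 0" if "W x *v u = 0" for x u using that by (rule W_inj)
        show "emeasure lebesgue (cell d k) \<noteq> 0" "emeasure lebesgue (cell d k) \<noteq> \<infinity>"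
          unfolding em using d(1) by simp_all
      qed
    qed
    have v_V: "v f k \<in> V" if f: "f \<in> F" and k: "k \<in> S" for f k
    proof -
      note [measurable] = F_meas[OF f]
      have "(\<integral>\<^sup>+x\<in>cell d k. ?w x (v f k) \<partial>lebesgue)
          \<le> (\<integral>\<^sup>+x. ennreal (3 powr P) * (?w x (f x - v f k) * indicator (cell d k) x + ?w x (f x)) \<partial>lebesgue)"
      proof (rule nn_integral_mono)
        fix x
        have "?w x (v f k) \<le> ennreal (3 powr P) * (?w x (f x - v f k) + ?w x (f x))"
          using wpow_add3_le[of q x P W "v f k - f x" "f x" 0] q by (simp add: wpow_minus_commute)
        then show "?w x (v f k) * indicator (cell d k) x
          \<le> ennreal (3 powr P) * (?w x (f x - v f k) * indicator (cell d k) x + ?w x (f x))"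
          by (simp add: indicator_def)
      qed
      also have "\<dots> = ennreal (3 powr P) *
          ((\<integral>\<^sup>+x\<in>cell d k. ?w x (f x - v f k) \<partial>lebesgue) + (\<integral>\<^sup>+x. ?w x (f x) \<partial>lebesgue))"
        by (subst nn_integral_cmult, measurable) (subst nn_integral_add, measurable)
      also have "\<dots> \<le> C"
        unfolding C_def
      proof (intro mult_left_mono add_mono)
        have "(\<integral>\<^sup>+x\<in>cell d k. ?w x (f x - v f k) \<partial>lebesgue) \<le> (\<Sum>k\<in>S. \<integral>\<^sup>+x\<in>cell d k. ?w x (f x - v f k) \<partial>lebesgue)"
          using k S(1) by (intro member_le_sum) auto
        with v[OF f] show "(\<integral>\<^sup>+x\<in>cell d k. ?w x (f x - v f k) \<partial>lebesgue) \<le> ennreal \<tau>" by (rule order_trans[rotated])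
        have "(\<integral>\<^sup>+x. ?w x (f x) \<partial>lebesgue) \<le> ennreal K * modular p \<rho> f"
          using w_le[OF F_meas[OF f], of UNIV] by simp
        also have "\<dots> \<le> ennreal K * M" unfolding M_def using f by (intro mult_left_mono SUP_upper) auto
        finally show "(\<integral>\<^sup>+x. ?w x (f x) \<partial>lebesgue) \<le> ennreal K * M" .
      qed simp
      finally show ?thesis using k by (auto simp: V_def)
    qed
    obtain b where b: "\<And>k. 0 \<le> b k" "\<And>k u. norm u \<le> 1 \<Longrightarrow>
        (\<integral>\<^sup>+x\<in>cell d k. ?w x u \<partial>lebesgue) \<le> ennreal (norm u * b k)"
    proof -
      have "\<exists>b\<ge>0. \<forall>u. norm u \<le> 1 \<longrightarrow> (\<integral>\<^sup>+x\<in>cell d k. ?w x u \<partial>lebesgue) \<le> ennreal (norm u * b)"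
        for k :: "'n \<Rightarrow> int"
      proof (rule modular_const_le)
        show "emeasure lebesgue (cell d k) \<noteq> \<infinity>" using emeasure_cell[OF d(1), of k] by simp
        show "set_integrable lebesgue (cell d k) (\<lambda>x. op_norm (W x) powr P)"
          using W_loc unfolding loc_integrable_def P_def
          by (blast intro: set_integrable_subset[OF _ cell_meas cell_subset_cbox] compact_cbox)
      qed (use q in auto)
      then have "\<forall>k. \<exists>b. 0 \<le> b \<and> (\<forall>u. norm u \<le> 1 \<longrightarrow> (\<integral>\<^sup>+x\<in>cell d k. ?w x u \<partial>lebesgue) \<le> ennreal (norm u * b))"
        by blast
      from choice[OF this] obtain b where "\<forall>k. 0 \<le> b k \<and>
          (\<forall>u. norm u \<le> 1 \<longrightarrow> (\<integral>\<^sup>+x\<in>cell d k. ?w x u \<partial>lebesgue) \<le> ennreal (norm u * b k))" ..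
      then show ?thesis by (intro that[of b]) simp_all
    qed
    define B where "B = (\<Sum>k\<in>S. b k)"
    have B: "0 \<le> B" using b(1) by (auto simp: B_def intro: sum_nonneg)
    \<comment> \<open>The cap 1 allows the linear bound for constants, and the quotient keeps the
      total over all cells of \<open>S\<close> below \<open>\<tau>\<close>. Adding 1 to
      \<open>B\<close> prevents division by zero.\<close>
    define \<eta> where "\<eta> = min 1 (\<tau> / (B + 1))"
    have \<eta>: "0 < \<eta>" "\<eta> \<le> 1" "\<eta> * B \<le> \<tau>"
    proof -
      show "0 < \<eta>" "\<eta> \<le> 1" using \<tau> B by (auto simp: \<eta>_def)
      have "\<eta> * B \<le> \<tau> / (B + 1) * (B + 1)"
        using \<tau> B by (intro mult_mono) (auto simp: \<eta>_def)
      then show "\<eta> * B \<le> \<tau>" using B by simp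
    qed
    have "\<exists>G. finite G \<and> G \<subseteq> F \<and> (\<forall>f\<in>F. \<exists>g\<in>G. \<forall>k\<in>S. norm (v f k - v g k) < \<eta>)"
      by (rule finite_net_of_bounded_family[OF S(1) V v_V \<eta>(1)])
    then obtain G where G: "finite G" "G \<subseteq> F" "\<And>f. f \<in> F \<Longrightarrow> \<exists>g\<in>G. \<forall>k\<in>S. norm (v f k - v g k) < \<eta>"
      by auto

    have close: "lux_norm p \<rho> (\<lambda>x. f x - g x) < e"
      if f: "f \<in> F" and g: "g \<in> F" and fg: "\<forall>k\<in>S. norm (v f k - v g k) < \<eta>" for f g
    proof -
      note [measurable] = F_meas[OF f] F_meas[OF g]
      have tail: "(\<integral>\<^sup>+x\<in>- ball 0 R. ?w x (h x) \<partial>lebesgue) \<le> ennreal \<tau>" if h: "h \<in> F" for h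
      proof -
        have "(\<integral>\<^sup>+x\<in>- ball 0 R. ?w x (h x) \<partial>lebesgue) \<le> ennreal K * modular_on p \<rho> (- ball 0 R) h"
          by (intro w_le F_meas h) auto
        also have "\<dots> \<le> ennreal K * ennreal (\<tau> / K)" by (intro mult_left_mono R h) simp
        also have "\<dots> = ennreal \<tau>" using K \<tau> by (subst ennreal_mult[symmetric]) auto
        finally show ?thesis .
      qed
      have mid: "(\<Sum>k\<in>S. \<integral>\<^sup>+x\<in>cell d k. ?w x (v f k - v g k) \<partial>lebesgue) \<le> ennreal \<tau>"
      proof -
        have "(\<Sum>k\<in>S. \<integral>\<^sup>+x\<in>cell d k. ?w x (v f k - v g k) \<partial>lebesgue) \<le> (\<Sum>k\<in>S. ennreal (\<eta> * b k))"
        proof (rule sum_mono)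
          fix k assume "k \<in> S"
          then have less: "norm (v f k - v g k) < \<eta>" using fg by blast
          then have "(\<integral>\<^sup>+x\<in>cell d k. ?w x (v f k - v g k) \<partial>lebesgue) \<le> ennreal (norm (v f k - v g k) * b k)"
            using \<eta>(2) by (intro b(2)) simp
          also have "\<dots> \<le> ennreal (\<eta> * b k)"
            using less b(1)[of k] by (intro ennreal_leI mult_right_mono) auto
          finally show "(\<integral>\<^sup>+x\<in>cell d k. ?w x (v f k - v g k) \<partial>lebesgue) \<le> ennreal (\<eta> * b k)" .
        qed
        also have "\<dots> = ennreal (\<eta> * B)"
          using \<eta>(1) b(1) by (simp add: sum_ennreal B_def sum_distrib_left)
        also have "\<dots> \<le> ennreal \<tau>" by (intro ennreal_leI \<eta>(3))
        finally show ?thesis .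
      qed
      \<comment> \<open>The five contributions are the two sampling errors, the distance between the
        sampled constants, and the two tails outside the ball of radius \<open>R\<close>.\<close>
      have "(\<integral>\<^sup>+x. ?w x (f x - g x) \<partial>lebesgue) \<le> ennreal (3 powr P) *
        ((\<Sum>k\<in>S. \<integral>\<^sup>+x\<in>cell d k. ?w x (f x - v f k) \<partial>lebesgue)
          + (\<Sum>k\<in>S. \<integral>\<^sup>+x\<in>cell d k. ?w x (v f k - v g k) \<partial>lebesgue)
          + (\<Sum>k\<in>S. \<integral>\<^sup>+x\<in>cell d k. ?w x (g x - v g k) \<partial>lebesgue)
          + (\<integral>\<^sup>+x\<in>- ball 0 R. ?w x (f x) \<partial>lebesgue) + (\<integral>\<^sup>+x\<in>- ball 0 R. ?w x (g x) \<partial>lebesgue))"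
        using S by (intro modular_diff_le W_meas q_meas F_meas f g q) auto
      also have "\<dots> \<le> ennreal (3 powr P) * (ennreal \<tau> + ennreal \<tau> + ennreal \<tau> + ennreal \<tau> + ennreal \<tau>)"
        by (intro mult_left_mono add_mono v f g mid tail) simp
      finally have "ennreal L * (\<integral>\<^sup>+x. ?w x (f x - g x) \<partial>lebesgue)
          \<le> ennreal L * (ennreal (3 powr P) * (ennreal \<tau> + ennreal \<tau> + ennreal \<tau> + ennreal \<tau> + ennreal \<tau>))"
        by (rule mult_left_mono) simp
      then have "ennreal L * (\<integral>\<^sup>+x. ?w x (f x - g x) \<partial>lebesgue) \<le> 1"
        using final by (rule order_trans)
      then have "lux_norm p \<rho> (\<lambda>x. f x - g x) \<le> t"
        unfolding L_def by (intro lux_norm_leI[OF t(1) rho_le_w pq q rho_nonneg W_meas q_meas]) auto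
      with t(2) show ?thesis by simp
    qed
    show "\<exists>k. finite k \<and> k \<subseteq> F \<and> (\<forall>f\<in>F. \<exists>g\<in>k. lux_norm p \<rho> (\<lambda>x. f x - g x) < e)"
    proof (intro exI[of _ G] conjI ballI G(1,2))
      fix f assume f: "f \<in> F"
      from G(3)[OF f] obtain g where "g \<in> G" "\<forall>k\<in>S. norm (v f k - v g k) < \<eta>" ..
      with G(2) f close show "\<exists>g\<in>G. lux_norm p \<rho> (\<lambda>x. f x - g x) < e"
        by (intro bexI[of _ g]) auto
    qed
  qed
qed

end
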